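(* Let $A$ be a real $d\times d$ matrix and let $(m_t)_{t\in\mathbb{N}}$ be i.i.d. $N(0,1)$ random variables. Put $\tilde M_t=m_tA$ (this is the random matrix associated with the BEKK-ARCH process $X_t=H_t^{1/2}Z_t$, $H_t=C+AX_{t-1}X_{t-1}^{\intercal}A^{\intercal}$, having $l=1$ term). Then the condition $$\inf_{n\in\mathbb{N}}\left\{\frac1n\,\mathbb{E}\left[\log\left\Vert\prod_{t=1}^{n}\tilde M_t\right\Vert\right]\right\}<0$$ holds if and only if $$\rho(A)<\exp\left\{\tfrac12\left[-\psi(1)+\log 2\right]\right\}=1.88736\ldots,$$ where $\psi$ is the digamma function.
   Context: $\rho(A)$ denotes the spectral radius of $A$. $\Vert\cdot\Vert$ is an arbitrary (submultiplicative) matrix norm, with $\log 0=-\infty$. In the BEKK-ARCH process, $(Z_t)$ is i.i.d. $N(0,I_d)$ and $C$ is a $d\times d$ positive definite matrix. *)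

theory Defs
  imports
    "HOL-Probability.Probability"
    "Jordan_Normal_Form.Spectral_Radius"
begin

text \<open>Only meant for nonnegative arguments.\<close>

definition elog :: "real \<Rightarrow> ereal" where
  "elog x = (if x = 0 then -\<infinity> else ereal (ln x))"

text \<open>Expectation of an extended real random variable as the difference of the integrals of
  positive and negative part (\<^const>\<open>e2ennreal\<close> sends negative values to 0). The value is only
  meaningful if one of the two integrals is finite; for the random variables used here
  the positive part is integrable.\<close>

definition ereal_expectation :: "'a measure \<Rightarrow> ('a \<Rightarrow> ereal) \<Rightarrow> ereal" where
  "ereal_expectation M f =
     enn2ereal (\<integral>\<^sup>+ \<omega>. e2ennreal (f \<omega>) \<partial>M) - enn2ereal (\<integral>\<^sup>+ \<omega>. e2ennreal (- f \<omega>) \<partial>M)"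

lemma ereal_expectation_ereal:
  assumes "integrable M f"
  shows "ereal_expectation M (\<lambda>\<omega>. ereal (f \<omega>)) = ereal (integral\<^sup>L M f)"
proof -
  have fin: "(\<integral>\<^sup>+ \<omega>. ennreal (g \<omega>) \<partial>M) < \<infinity>" if "integrable M g" for g :: "'a \<Rightarrow> real"
  proof -
    have "(\<integral>\<^sup>+ \<omega>. ennreal (g \<omega>) \<partial>M) \<le> (\<integral>\<^sup>+ \<omega>. ennreal (norm (g \<omega>)) \<partial>M)"
      by (intro nn_integral_mono ennreal_leI) simp
    also have "\<dots> < \<infinity>"
      using that by (simp add: integrable_iff_bounded)
    finally show ?thesis .
  qed
  have *: "enn2ereal x = ereal (enn2real x)" if "x < \<infinity>" for x
    using that by (cases x) auto
  show ?thesis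
    using fin[OF assms] fin[of "\<lambda>\<omega>. - f \<omega>"] assms
    by (simp add: ereal_expectation_def real_lebesgue_integral_def * flip: ennreal.abs_eq)
qed

definition matrix_norm :: "nat \<Rightarrow> (real mat \<Rightarrow> real) \<Rightarrow> bool" where
  "matrix_norm d N \<longleftrightarrow>
     (\<forall>P \<in> carrier_mat d d. 0 \<le> N P \<and> (N P = 0 \<longleftrightarrow> P = 0\<^sub>m d d)) \<and>
     (\<forall>P \<in> carrier_mat d d. \<forall>c. N (c \<cdot>\<^sub>m P) = \<bar>c\<bar> * N P) \<and>
     (\<forall>P \<in> carrier_mat d d. \<forall>Q \<in> carrier_mat d d. N (P + Q) \<le> N P + N Q) \<and>
     (\<forall>P \<in> carrier_mat d d. \<forall>Q \<in> carrier_mat d d. N (P * Q) \<le> N P * N Q)"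

text \<open>The product \<open>P 1 * P 2 * \<dots> * P n\<close> of \<open>d \<times> d\<close> matrices.\<close>

definition mat_prod :: "nat \<Rightarrow> nat \<Rightarrow> (nat \<Rightarrow> real mat) \<Rightarrow> real mat" where
  "mat_prod d n P = foldr (\<lambda>t Q. P t * Q) [1..<Suc n] (1\<^sub>m d)"

end

theory Submission
  imports Defs
begin

text \<open>
  Since \<open>\<Prod>t. m t A = (\<Prod>t. m t) A\<^sup>n\<close>, the \<open>n\<close>-th term of the infimum is
  \<open>(1/n) log N(A\<^sup>n) + E log |m|\<close>, so it is negative iff \<open>N(A\<^sup>n) < r\<^sup>n\<close> with
  \<open>r = exp (- E log |m|)\<close>; by Gelfand's formula such an \<open>n\<close> exists iff the spectral radius
  is less than \<open>r\<close>. Here \<open>E log |m|\<close> is the derivative at \<open>s = 0\<close> of the absolute moment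
  \<open>E |m| powr s\<close>, which is a Gamma function value; this gives
  \<open>E log |m| = (Digamma (1/2) + ln 2) / 2 = (Digamma 1 - ln 2) / 2\<close>.
\<close>

subsection \<open>The logarithmic moment of the normal distribution\<close>

text \<open>The substitution t = x^2/2 turns Euler's integral for Gamma((s+1)/2) into a multiple of
  the moment over the positive half-line, and evenness doubles it. The condition s > -1 is
  convergence of that integral at 0.\<close>

lemma std_normal_abs_powr_moment:
  fixes s :: real
  assumes "s > -1"
  shows "has_bochner_integral lborel (\<lambda>x. std_normal_density x * \<bar>x\<bar> powr s)
           (2 powr (s / 2) * Gamma ((s + 1) / 2) / sqrt pi)"
proof -
  define f where "f t = t powr ((s + 1) / 2 - 1) / exp t" for t :: real
  define h where "h x = std_normal_density x * \<bar>x\<bar> powr s" for x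
  \<comment> \<open>\<open>c\<close> collects the 1/sqrt(2 pi) of the density and the power of 2
    that (x^2/2) powr ((s-1)/2) leaves behind; see \<open>h_eq\<close>.\<close>
  define c where "c = 2 powr ((s - 1) / 2) / sqrt (2 * pi)"
  have f_int: "(f has_integral Gamma ((s + 1) / 2)) {0<..}"
  proof -
    have "((\<lambda>t. if t \<in> {0<..} then f t else 0) has_integral Gamma ((s + 1) / 2)) {0..}"
      using assms by (intro has_integral_eq[OF _ Gamma_integral_real]) (auto simp: f_def)
    then show ?thesis
      by (subst (asm) has_integral_restrict) auto
  qed
  have f_abs: "f absolutely_integrable_on {0<..}"
    using f_int by (intro nonnegative_absolutely_integrable_1) (auto simp: f_def integrable_on_def)
  have img: "(\<lambda>x. x\<^sup>2 / 2) ` {0<..} = {(0::real)<..}"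
  proof safe
    fix y :: real assume "0 < y"
    then show "y \<in> (\<lambda>x. x\<^sup>2 / 2) ` {0<..}"
      by (intro image_eqI[of _ _ "sqrt (2 * y)"]) auto
  qed simp
  \<comment> \<open>The factor |x| is the absolute value of the derivative of x^2/2.\<close>
  have cov: "(\<lambda>x. \<bar>x\<bar> * f (x\<^sup>2 / 2)) absolutely_integrable_on {0<..} \<and>
      integral {0<..} (\<lambda>x. \<bar>x\<bar> * f (x\<^sup>2 / 2)) = Gamma ((s + 1) / 2)"
  proof (rule has_absolute_integral_change_of_variables_1'[of "{0<..}" "\<lambda>x. x\<^sup>2 / 2" "\<lambda>x. x" f,
        THEN iffD2])
    show "((\<lambda>x. x\<^sup>2 / 2) has_real_derivative x) (at x within {0<..})" if "x \<in> {0<..}" for x :: real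
      by (auto intro!: derivative_eq_intros)
    show "inj_on (\<lambda>x. x\<^sup>2 / 2 :: real) {0<..}"
      by (auto simp: inj_on_def power2_eq_iff)
  qed (use f_abs f_int in \<open>auto simp: img integral_unique\<close>)
  have h_eq: "h x = c * (\<bar>x\<bar> * f (x\<^sup>2 / 2))" if "x > 0" for x
  proof -
    have "f (x\<^sup>2 / 2) = (x\<^sup>2 / 2) powr ((s - 1) / 2) * exp (- x\<^sup>2 / 2)"
      by (simp add: f_def exp_minus divide_simps)
    also have "(x\<^sup>2 / 2) powr ((s - 1) / 2) = x powr (s - 1) / 2 powr ((s - 1) / 2)"
      using that by (simp add: powr_divide powr_powr diff_divide_distrib flip: powr_numeral)
    also have "x powr (s - 1) = x powr s / x"
      using that by (simp add: powr_diff)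
    finally show ?thesis
      using that by (simp add: h_def c_def normal_density_def)
  qed
  have "has_bochner_integral lborel (\<lambda>x. indicator {0..} x *\<^sub>R h x) (c * Gamma ((s + 1) / 2))"
  proof -
    have "has_bochner_integral lebesgue (\<lambda>x. indicator {0<..} x *\<^sub>R (\<bar>x\<bar> * f (x\<^sup>2 / 2)))
        (Gamma ((s + 1) / 2))"
      using cov by (auto simp: has_bochner_integral_iff set_integrable_def set_lebesgue_integral_def
        simp flip: set_lebesgue_integral_eq_integral(2))
    then have "has_bochner_integral lebesgue
        (\<lambda>x. c * (indicator {0<..} x *\<^sub>R (\<bar>x\<bar> * f (x\<^sup>2 / 2)))) (c * Gamma ((s + 1) / 2))"
      by (rule has_bochner_integral_mult_right)
    \<comment> \<open>Open and closed half-line give the same function because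
      \<open>h 0 = 0\<close>: in HOL, \<open>0 powr s = 0\<close> for every
      \<open>s\<close>.\<close>
    also have "(\<lambda>x. c * (indicator {0<..} x *\<^sub>R (\<bar>x\<bar> * f (x\<^sup>2 / 2)))) =
        (\<lambda>x. indicator {0..} x *\<^sub>R h x)"
      by (auto simp: fun_eq_iff indicator_def h_eq) (simp add: h_def)
    finally show ?thesis
      by (simp add: has_bochner_integral_iff integrable_completion integral_completion h_def)
  qed
  then have "has_bochner_integral lborel h (2 *\<^sub>R (c * Gamma ((s + 1) / 2)))"
    by (rule has_bochner_integral_even_function) (simp add: h_def normal_density_def)
  also have "2 *\<^sub>R (c * Gamma ((s + 1) / 2)) = 2 powr (s / 2) * Gamma ((s + 1) / 2) / sqrt pi"
  proof -
    have "2 powr (s / 2) = 2 powr ((s - 1) / 2) * 2 powr (1 / 2)"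
      by (simp flip: powr_add add: field_simps)
    then have "2 powr (s / 2) = 2 powr ((s - 1) / 2) * sqrt 2"
      by (simp add: powr_half_sqrt)
    moreover have "2 = sqrt 2 * sqrt 2" by simp
    ultimately show ?thesis
      by (simp add: c_def real_sqrt_mult field_simps)
  qed
  finally show ?thesis by (simp add: h_def [abs_def])
qed

text \<open>Differentiation under the integral sign at s = 0: the difference quotients of |x| powr s
  tend to ln |x|, their integrals are difference quotients of the moment function \<open>G\<close>,
  and dominated convergence identifies the limit with G'(0).\<close>

lemma std_normal_ln_abs:
  "has_bochner_integral lborel (\<lambda>x. std_normal_density x * ln \<bar>x\<bar>) (- ((euler_mascheroni + ln 2) / 2))"
proof -
  define G :: "real \<Rightarrow> real" where "G s = 2 powr (s / 2) * Gamma ((s + 1) / 2) / sqrt pi" for s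
  define \<epsilon> :: "nat \<Rightarrow> real" where "\<epsilon> n = inverse (real (Suc n))" for n
  \<comment> \<open>\<open>\<bar>x\<bar> powr 0\<close> is 1 except at \<open>x = 0\<close>, where it is 0\<close>
  define u where "u n x = std_normal_density x * ((\<bar>x\<bar> powr \<epsilon> n - \<bar>x\<bar> powr 0) / \<epsilon> n)" for n x
  \<comment> \<open>Dominating function: the square controls the quotients from above, the power
    -1/2 from below. Both exponents exceed -1, so both moments are finite.\<close>
  define w where "w x = std_normal_density x * (\<bar>x\<bar> powr 2 + 2 * \<bar>x\<bar> powr (-1/2))" for x
  have \<epsilon>: "0 < \<epsilon> n" "\<epsilon> n \<le> 1" for n
    by (simp_all add: \<epsilon>_def inverse_le_1_iff)
  have \<epsilon>_lim: "\<epsilon> \<longlonglongrightarrow> 0"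
    unfolding \<epsilon>_def by (rule LIMSEQ_inverse_real_of_nat)
  have moment: "has_bochner_integral lborel (\<lambda>x. std_normal_density x * \<bar>x\<bar> powr s) (G s)"
    if "s > -1" for s
    unfolding G_def using that by (rule std_normal_abs_powr_moment)
  have u_int: "has_bochner_integral lborel (u n) ((G (\<epsilon> n) - G 0) / \<epsilon> n)" for n
  proof -
    have "has_bochner_integral lborel
        (\<lambda>x. (std_normal_density x * \<bar>x\<bar> powr \<epsilon> n - std_normal_density x * \<bar>x\<bar> powr 0) / \<epsilon> n)
        ((G (\<epsilon> n) - G 0) / \<epsilon> n)"
      using \<epsilon>[of n] by (intro has_bochner_integral_divide has_bochner_integral_diff moment) auto
    then show ?thesis
      by (simp add: u_def [abs_def] algebra_simps diff_divide_distrib)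
  qed
  have w_int: "integrable lborel w"
  proof -
    have "integrable lborel (\<lambda>x. std_normal_density x * \<bar>x\<bar> powr 2 +
        2 * (std_normal_density x * \<bar>x\<bar> powr (-1/2)))"
      using moment[of 2] moment[of "-1/2"]
      by (intro Bochner_Integration.integrable_add integrable_mult_right)
         (auto simp: has_bochner_integral_iff)
    then show ?thesis
      by (simp add: w_def [abs_def] algebra_simps)
  qed
  have bound: "norm (u n x) \<le> w x" if "x \<noteq> 0" for n x
  proof -
    define a where "a = \<bar>x\<bar>"
    define r where "r = (a powr \<epsilon> n - 1) / \<epsilon> n"
    have a: "a > 0" using that by (simp add: a_def)
    \<comment> \<open>The inequality ln y <= y - 1 is applied with y =
      \<open>a powr \<epsilon> n\<close>, and below with y = \<open>a powr (-1/2)\<close>.\<close>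
    have "ln a * \<epsilon> n \<le> a powr \<epsilon> n - 1"
      using ln_le_minus_one[of "a powr \<epsilon> n"] a by (simp add: ln_powr mult.commute)
    then have "ln a \<le> r"
      using \<epsilon>[of n] by (simp add: r_def field_simps)
    moreover have "- 2 * a powr (-1/2) \<le> ln a"
      using ln_le_minus_one[of "a powr (-1/2)"] a by (simp add: ln_powr)
    ultimately have lower: "- 2 * a powr (-1/2) \<le> r" by linarith
    have "a powr 2 \<ge> 0" by simp
    have upper: "r \<le> a powr 2"
    proof (cases "a \<le> 1")
      case True
      then have "a powr \<epsilon> n \<le> 1"
        using a \<epsilon>[of n] by (simp add: powr_le1)
      then have "r \<le> 0" using \<epsilon>[of n] by (simp add: r_def field_simps)
      then show ?thesis using \<open>a powr 2 \<ge> 0\<close> by linarith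
    next
      case False
      \<comment> \<open>The same inequality with the reciprocal power; multiplying by
        \<open>a powr \<epsilon> n\<close> bounds \<open>r\<close> from above, and a > 1 then allows
        the exponent to be raised to 1.\<close>
      have "1 - a powr (- \<epsilon> n) \<le> \<epsilon> n * ln a"
        using ln_le_minus_one[of "a powr (- \<epsilon> n)"] a by (simp add: ln_powr)
      then have "a powr \<epsilon> n * (1 - a powr (- \<epsilon> n)) \<le> a powr \<epsilon> n * (\<epsilon> n * ln a)"
        by (intro mult_left_mono) auto
      then have "a powr \<epsilon> n - 1 \<le> \<epsilon> n * (a powr \<epsilon> n * ln a)"
        using a by (simp add: algebra_simps flip: powr_add)
      then have "r \<le> a powr \<epsilon> n * ln a"
        using \<epsilon>[of n] by (simp add: r_def field_simps)
      also have "\<dots> \<le> a powr 1 * a"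
        using False \<epsilon>[of n] a ln_le_minus_one[of a] by (intro mult_mono powr_mono) auto
      finally show ?thesis using a by (simp add: power2_eq_square)
    qed
    have "\<bar>r\<bar> \<le> a powr 2 + 2 * a powr (-1/2)"
      using lower upper \<open>a powr 2 \<ge> 0\<close> powr_ge_zero[of a "-1/2"] by linarith
    then have "std_normal_density x * \<bar>r\<bar> \<le> w x"
      unfolding w_def by (intro mult_left_mono) (auto simp: a_def)
    then show ?thesis
      using a by (simp add: u_def r_def a_def abs_mult)
  qed
  have ptwise: "(\<lambda>n. u n x) \<longlonglongrightarrow> std_normal_density x * ln \<bar>x\<bar>" if "x \<noteq> 0" for x
  proof -
    have "((\<lambda>s. \<bar>x\<bar> powr s) has_real_derivative ln \<bar>x\<bar>) (at 0)"
      using that by (auto intro!: derivative_eq_intros)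
    then have "((\<lambda>h. (\<bar>x\<bar> powr h - \<bar>x\<bar> powr 0) / h) \<longlongrightarrow> ln \<bar>x\<bar>) (at 0)"
      by (simp add: DERIV_def)
    then have "(\<lambda>n. (\<bar>x\<bar> powr \<epsilon> n - \<bar>x\<bar> powr 0) / \<epsilon> n) \<longlonglongrightarrow> ln \<bar>x\<bar>"
      by (rule filterlim_compose)
         (use \<epsilon>(1) \<epsilon>_lim in \<open>auto simp: filterlim_at less_imp_neq[THEN not_sym] intro!: always_eventually\<close>)
    then show ?thesis
      unfolding u_def by (intro tendsto_intros)
  qed
  have ae: "AE x in lborel. x \<noteq> (0::real)"
    by (rule AE_lborel_singleton)
  have "AE x in lborel. (\<lambda>n. u n x) \<longlonglongrightarrow> std_normal_density x * ln \<bar>x\<bar>"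
    using ae by eventually_elim (rule ptwise)
  moreover have "AE x in lborel. norm (u n x) \<le> w x" for n
    using ae by eventually_elim (rule bound)
  moreover have "u n \<in> borel_measurable lborel" for n
    unfolding u_def by measurable
  moreover have "(\<lambda>x. std_normal_density x * ln \<bar>x\<bar>) \<in> borel_measurable lborel"
    by measurable
  ultimately have dc: "integrable lborel (\<lambda>x. std_normal_density x * ln \<bar>x\<bar>)"
    "(\<lambda>n. integral\<^sup>L lborel (u n)) \<longlonglongrightarrow> (LBINT x. std_normal_density x * ln \<bar>x\<bar>)"
    using w_int integrable_dominated_convergence[of _ lborel u w]
      integral_dominated_convergence[of _ lborel u w] by blast+
  \<comment> \<open>\<open>Digamma\<close> is the logarithmic derivative of \<open>Gamma\<close>, so
    the bracket is the logarithmic derivative of \<open>G\<close> at 0.\<close>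
  have "(G has_real_derivative G 0 * (ln 2 / 2 + Digamma (1 / 2) / 2)) (at 0)"
    unfolding G_def
    by (auto intro!: derivative_eq_intros simp: divide_simps) (simp add: algebra_simps)
  also have "G 0 = 1"
    by (simp add: G_def Gamma_one_half_real)
  also have "1 * (ln 2 / 2 + Digamma (1 / 2) / 2) = - ((euler_mascheroni + ln 2) / 2 :: real)"
    by (simp add: Digamma_one_half field_simps)
  finally have "((\<lambda>h. (G h - G 0) / h) \<longlongrightarrow> - ((euler_mascheroni + ln 2) / 2)) (at 0)"
    by (simp add: DERIV_def)
  then have "(\<lambda>n. (G (\<epsilon> n) - G 0) / \<epsilon> n) \<longlonglongrightarrow> - ((euler_mascheroni + ln 2) / 2)"
    by (rule filterlim_compose)
       (use \<epsilon>(1) \<epsilon>_lim in \<open>auto simp: filterlim_at less_imp_neq[THEN not_sym] intro!: always_eventually\<close>)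
  moreover have "integral\<^sup>L lborel (u n) = (G (\<epsilon> n) - G 0) / \<epsilon> n" for n
    using u_int by (simp add: has_bochner_integral_iff)
  ultimately have "(LBINT x. std_normal_density x * ln \<bar>x\<bar>) = - ((euler_mascheroni + ln 2) / 2)"
    using dc(2) by (simp add: LIMSEQ_unique)
  with dc(1) show ?thesis by (simp add: has_bochner_integral_iff)
qed

subsection \<open>Numerical bounds\<close>

text \<open>The final estimate contains 8 ln 2, so the width 4e-8 contributes an uncertainty of
  3.2e-7, well below the 8.4e-6 between the endpoints aimed at.\<close>

lemma ln_2_bounds: "ln (2::real) \<in> {0.69314717..0.69314721}"
  using ln_approx_bounds[of 2 7] by (simp add: lessThan_nat_numeral lessThan_Suc power_divide)

text \<open>Twice this bound and twice the next one are the endpoints 1.2703592 and 1.2703676 used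
  to enclose \<open>euler_mascheroni + ln 2\<close>.\<close>

lemma ln_188736_le: "ln (1.88736 :: real) \<le> 0.6351796"
  using ln_approx_bounds[of "1.88736" 5] by (simp add: lessThan_nat_numeral lessThan_Suc power_divide)

lemma ln_188737_ge: "0.6351838 \<le> ln (1.88737 :: real)"
  using ln_approx_bounds[of "1.88737" 5] by (simp add: lessThan_nat_numeral lessThan_Suc power_divide)

text \<open>Fixed-point arithmetic: rounding 1/k down to a multiple of 1/K loses at most 1/K per
  term, which leaves an integer sum to evaluate.\<close>

lemma harm_bounds:
  fixes K n :: nat
  assumes "K > 0"
  shows "real (\<Sum>k=1..n. K div k) / K \<le> harm n"
    and "harm n \<le> (real (\<Sum>k=1..n. K div k) + n) / K"
proof -
  have "real (K div k) / K \<le> inverse (real k) \<and> inverse (real k) \<le> (real (K div k) + 1) / K"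
    if "k \<in> {1..n}" for k
  proof -
    have "real (K div k) \<le> real K / real k"
      by (rule of_nat_div_le_of_nat)
    moreover have "real K / real k \<le> real (K div k) + 1"
      using floor_divide_of_nat_eq[of K k, where 'a = real] by linarith
    ultimately show ?thesis
      using assms that by (simp add: field_simps)
  qed
  then have "(\<Sum>k=1..n. real (K div k) / K) \<le> harm n"
    and "harm n \<le> (\<Sum>k=1..n. (real (K div k) + 1) / K)"
    unfolding harm_def by (auto intro!: sum_mono)
  then show "real (\<Sum>k=1..n. K div k) / K \<le> harm n"
    and "harm n \<le> (real (\<Sum>k=1..n. K div k) + n) / K"
    by (simp_all add: sum_divide_distrib [symmetric] sum.distrib)
qed

text \<open>The sum is evaluated over \<^typ>\<open>int\<close>, whose numerals are binary in the code equations,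
  while those of \<^typ>\<open>nat\<close> are unary.\<close>

lemma sum_div_511: "(\<Sum>k=1..511::nat. 10000000000 div k) = (68145633848::nat)"
proof -
  have "int (\<Sum>k=1..511. 10000000000 div k) = (\<Sum>k\<in>int ` {1..511}. 10000000000 div k)"
    by (subst sum.reindex) (simp_all add: zdiv_int)
  also have "int ` {1..511} = set [1..511]"
    by (simp only: image_int_atLeastAtMost set_upto of_nat_1 of_nat_numeral)
  also have "(\<Sum>k\<in>set [1..511]. 10000000000 div k) = (\<Sum>k\<leftarrow>[1..511]. 10000000000 div k :: int)"
    by (rule sum_list_distinct_conv_sum_set [OF distinct_upto, symmetric])
  also have "\<dots> = 68145633848"
    by code_simp
  finally show ?thesis by linarith
qed

text \<open>The choice of 511 makes the logarithm in the bounds for the Euler-Mascheroni constant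
  a multiple of \<open>ln 2\<close>.\<close>

lemma critical_value_bounds:
  "1.88736 \<le> exp ((euler_mascheroni + ln 2) / 2 :: real)"
  "exp ((euler_mascheroni + ln 2) / 2 :: real) < 1.88737"
proof -
  \<comment> \<open>With K = 10^10 the total rounding error is 511/10^10, about 5.1e-8.\<close>
  have harm: "6.81456338 \<le> (harm 511 :: real)" "harm 511 \<le> (6.81456344 :: real)"
    using harm_bounds[of 10000000000 511, unfolded sum_div_511] by simp_all
  have "ln (512 :: real) = ln (2 ^ 9)" by simp
  also have "\<dots> = 9 * ln 2" by (subst ln_realpow) simp_all
  finally have ln_512: "ln (512 :: real) = 9 * ln 2" .
  \<comment> \<open>The corrections are 1/(2 * 512) and 1/(2 * 511); they differ by less than 2e-6,
    which the required precision tolerates.\<close>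
  have "harm 511 - 9 * ln 2 + 1 / 1024 \<le> (euler_mascheroni :: real)"
    and "(euler_mascheroni :: real) \<le> harm 511 - 9 * ln 2 + 1 / 1022"
    using euler_mascheroni_bounds[of 511] by (simp_all add: ln_512)
  with harm have "1.2703592 \<le> euler_mascheroni + ln (2 :: real)" "euler_mascheroni + ln (2 :: real) < 1.2703676"
    using ln_2_bounds by simp_all
  then have "ln 1.88736 \<le> (euler_mascheroni + ln 2) / (2 :: real)"
    and "(euler_mascheroni + ln 2) / 2 < ln (1.88737 :: real)"
    using ln_188736_le ln_188737_ge by simp_all
  then have "exp (ln 1.88736) \<le> exp ((euler_mascheroni + ln 2) / 2 :: real)"
    and "exp ((euler_mascheroni + ln 2) / 2) < exp (ln (1.88737 :: real))"
    by (simp_all only: exp_le_cancel_iff exp_less_cancel_iff)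
  then show "1.88736 \<le> exp ((euler_mascheroni + ln 2) / 2 :: real)"
    and "exp ((euler_mascheroni + ln 2) / 2 :: real) < 1.88737"
    by simp_all
qed

subsection \<open>Submultiplicative matrix norms and the spectral radius\<close>

text \<open>Compare both sides of the eigenvector equation in a coordinate where the eigenvector has
  maximal modulus \<open>s\<close>.\<close>

lemma eigenvalue_norm_bound:
  fixes B :: "complex mat"
  assumes B: "B \<in> carrier_mat n n" and "eigenvalue B \<mu>" and c: "norm_bound B c"
  shows "norm \<mu> \<le> real n * c"
proof -
  from \<open>eigenvalue B \<mu>\<close> obtain v where v: "v \<in> carrier_vec n" "v \<noteq> 0\<^sub>v n" "B *\<^sub>v v = \<mu> \<cdot>\<^sub>v v"
    using B by (auto simp: eigenvalue_def eigenvector_def)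
  obtain l where l: "l < n" "v $ l \<noteq> 0"
    using v(1,2) by (metis carrier_vecD eq_vecI index_zero_vec(1) index_zero_vec(2))
  define s where "s = Max ((\<lambda>i. norm (v $ i)) ` {..<n})"
  have "s \<in> (\<lambda>i. norm (v $ i)) ` {..<n}"
    unfolding s_def using l by (intro Max_in) auto
  then obtain i where i: "i < n" "s = norm (v $ i)" by auto
  have s: "norm (v $ j) \<le> s" if "j < n" for j
    unfolding s_def using that by (intro Max_ge) auto
  have "s > 0"
    using s[of l] l by (auto intro: less_le_trans[of _ "norm (v $ l)"])
  have entry: "norm (B $$ (i, j)) \<le> c" if "i < n" "j < n" for i j
    using c B that by (auto simp: norm_bound_def)
  have "norm \<mu> * s = norm ((B *\<^sub>v v) $ i)"
    using v i by (simp add: norm_mult)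
  also have "(B *\<^sub>v v) $ i = (\<Sum>j<n. B $$ (i, j) * v $ j)"
    using B v(1) i by (simp add: scalar_prod_def atLeast0LessThan)
  also have "norm \<dots> \<le> (\<Sum>j<n. norm (B $$ (i, j)) * norm (v $ j))"
    by (rule order_trans[OF norm_sum]) (simp add: norm_mult)
  \<comment> \<open>\<open>entry[of i i]\<close> supplies 0 <= c for the monotonicity of the
    product.\<close>
  also have "\<dots> \<le> (\<Sum>j<n. c * s)"
    using entry[of i i] i by (intro sum_mono mult_mono entry s) (auto intro: order_trans[OF norm_ge_zero])
  finally show ?thesis
    using \<open>s > 0\<close> by (simp add: mult.assoc [symmetric])
qed

section \<open>Matrix units\<close>

definition mat_unit :: "nat \<Rightarrow> nat \<times> nat \<Rightarrow> real mat" where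
  "mat_unit d p = mat d d (\<lambda>q. if q = p then 1 else 0)"

lemma mat_unit_carrier [simp]: "mat_unit d p \<in> carrier_mat d d"
  by (simp add: mat_unit_def)

lemma index_mat_unit: "i < d \<Longrightarrow> j < d \<Longrightarrow> mat_unit d p $$ (i, j) = (if (i, j) = p then 1 else 0)"
  by (simp add: mat_unit_def)

lemma mat_unit_nonzero: "i < d \<Longrightarrow> j < d \<Longrightarrow> mat_unit d (i, j) \<noteq> 0\<^sub>m d d"
  by (auto simp: mat_unit_def mat_eq_iff)

text \<open>The left factor keeps only row \<open>i\<close>, the right factor only column
  \<open>j\<close>.\<close>

lemma mat_unit_sandwich:
  assumes P: "P \<in> carrier_mat d d" and "i < d" "j < d"
  shows "mat_unit d (i, i) * P * mat_unit d (j, j) = P $$ (i, j) \<cdot>\<^sub>m mat_unit d (i, j)"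
proof (rule eq_matI)
  have left: "(mat_unit d (i, i) * P) $$ (a, b) = (if a = i then P $$ (i, b) else 0)"
    if "a < d" "b < d" for a b
  proof -
    have "(mat_unit d (i, i) * P) $$ (a, b) = (\<Sum>k<d. if k = i then if a = i then P $$ (i, b) else 0 else 0)"
    proof -
      have "(mat_unit d (i, i) * P) $$ (a, b) = (\<Sum>k<d. mat_unit d (i, i) $$ (a, k) * P $$ (k, b))"
        using that P by (simp add: mat_unit_def scalar_prod_def atLeast0LessThan)
      also have "\<dots> = (\<Sum>k<d. if k = i then if a = i then P $$ (i, b) else 0 else 0)"
        using that by (intro sum.cong) (auto simp: index_mat_unit)
      finally show ?thesis .
    qed
    then show ?thesis using \<open>i < d\<close> by simp
  qed
  fix a b assume "a < dim_row (P $$ (i, j) \<cdot>\<^sub>m mat_unit d (i, j))"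
    "b < dim_col (P $$ (i, j) \<cdot>\<^sub>m mat_unit d (i, j))"
  then have ab: "a < d" "b < d" by (simp_all add: mat_unit_def)
  have "(mat_unit d (i, i) * P * mat_unit d (j, j)) $$ (a, b) =
      (\<Sum>k<d. (mat_unit d (i, i) * P) $$ (a, k) * mat_unit d (j, j) $$ (k, b))"
    using ab carrier_matD[OF mult_carrier_mat[OF mat_unit_carrier P]]
    by (subst index_mult_mat(1)) (auto simp: scalar_prod_def atLeast0LessThan mat_unit_def
      simp del: index_mult_mat(1))
  also have "\<dots> = (\<Sum>k<d. if k = j then if a = i \<and> b = j then P $$ (i, j) else 0 else 0)"
    using ab by (intro sum.cong) (auto simp: left index_mat_unit)
  finally show "(mat_unit d (i, i) * P * mat_unit d (j, j)) $$ (a, b) =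
      (P $$ (i, j) \<cdot>\<^sub>m mat_unit d (i, j)) $$ (a, b)"
    using ab \<open>j < d\<close> by (simp add: mat_unit_def)
qed (simp_all add: mat_unit_def)

section \<open>Comparing a matrix norm with entries and eigenvalues\<close>

context
  fixes d :: nat and N :: "real mat \<Rightarrow> real"
  assumes N: "matrix_norm d N"
begin

lemma matrix_norm_nonneg: "P \<in> carrier_mat d d \<Longrightarrow> 0 \<le> N P"
  using N by (simp add: matrix_norm_def)

lemma matrix_norm_eq_0: "P \<in> carrier_mat d d \<Longrightarrow> N P = 0 \<longleftrightarrow> P = 0\<^sub>m d d"
  using N by (simp add: matrix_norm_def)

lemma matrix_norm_smult: "P \<in> carrier_mat d d \<Longrightarrow> N (c \<cdot>\<^sub>m P) = \<bar>c\<bar> * N P"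
  using N by (simp add: matrix_norm_def)

lemma matrix_norm_add:
  "P \<in> carrier_mat d d \<Longrightarrow> Q \<in> carrier_mat d d \<Longrightarrow> N (P + Q) \<le> N P + N Q"
  using N by (simp add: matrix_norm_def)

lemma matrix_norm_mult:
  "P \<in> carrier_mat d d \<Longrightarrow> Q \<in> carrier_mat d d \<Longrightarrow> N (P * Q) \<le> N P * N Q"
  using N by (simp add: matrix_norm_def)

text \<open>The exponent starts at 1 because the norm of the identity matrix may exceed 1.\<close>

lemma matrix_norm_pow_le:
  assumes P: "P \<in> carrier_mat d d"
  shows "N (P ^\<^sub>m Suc k) \<le> N P ^ Suc k"
proof (induction k)
  case 0
  then show ?case using P by simp
next
  case (Suc k)
  have "N (P ^\<^sub>m Suc (Suc k)) \<le> N (P ^\<^sub>m Suc k) * N P"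
    using matrix_norm_mult[OF pow_carrier_mat[OF P, of "Suc k"] P] by simp
  also have "\<dots> \<le> N P ^ Suc k * N P"
    using Suc P by (intro mult_right_mono matrix_norm_nonneg)
  finally show ?case by (simp add: mult_ac)
qed

text \<open>Multiplication by matrix units isolates an entry, so submultiplicativity gives this half of
  the equivalence of norms without a compactness argument.\<close>

lemma entry_le_matrix_norm:
  "\<exists>K. \<forall>P \<in> carrier_mat d d. \<forall>i < d. \<forall>j < d. \<bar>P $$ (i, j)\<bar> \<le> K * N P"
proof -
  \<comment> \<open>The quotient comes from applying the norm to \<open>mat_unit_sandwich\<close>.
    Summing these nonnegative constants over all positions gives one that serves every
    entry.\<close>
  define k where "k = (\<lambda>(i, j). N (mat_unit d (i, i)) * N (mat_unit d (j, j)) / N (mat_unit d (i, j)))"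
  have "\<bar>P $$ (i, j)\<bar> \<le> (\<Sum>p\<in>{..<d} \<times> {..<d}. k p) * N P"
    if P: "P \<in> carrier_mat d d" and ij: "i < d" "j < d" for P i j
  proof -
    have pos: "N (mat_unit d (i, j)) > 0"
      using mat_unit_nonzero[OF ij] matrix_norm_nonneg[of "mat_unit d (i, j)"]
        matrix_norm_eq_0[of "mat_unit d (i, j)"] by simp
    have "\<bar>P $$ (i, j)\<bar> * N (mat_unit d (i, j)) = N (mat_unit d (i, i) * P * mat_unit d (j, j))"
      using P ij by (simp add: mat_unit_sandwich matrix_norm_smult)
    also have "\<dots> \<le> N (mat_unit d (i, i) * P) * N (mat_unit d (j, j))"
      using P by (intro matrix_norm_mult mult_carrier_mat[of _ d d]) auto
    also have "\<dots> \<le> N (mat_unit d (i, i)) * N P * N (mat_unit d (j, j))"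
      using P by (intro mult_right_mono matrix_norm_mult matrix_norm_nonneg) auto
    finally have "\<bar>P $$ (i, j)\<bar> \<le> k (i, j) * N P"
      using pos by (simp add: k_def field_simps)
    also have "\<dots> \<le> (\<Sum>p\<in>{..<d} \<times> {..<d}. k p) * N P"
      using ij P
      by (intro mult_right_mono member_le_sum matrix_norm_nonneg)
         (auto simp: k_def intro!: divide_nonneg_nonneg mult_nonneg_nonneg matrix_norm_nonneg)
    finally show ?thesis .
  qed
  then show ?thesis by blast
qed

text \<open>Expand the matrix in matrix units and apply the triangle inequality; the induction runs
  over the set \<open>S\<close> of entries that are kept, the others being set to 0.\<close>

lemma matrix_norm_le_entries:
  assumes P: "P \<in> carrier_mat d d" and c: "norm_bound P c"
  shows "N P \<le> c * (\<Sum>p\<in>{..<d} \<times> {..<d}. N (mat_unit d p))"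
proof -
  have "N (mat d d (\<lambda>p. if p \<in> S then P $$ p else 0)) \<le> (\<Sum>p\<in>S. \<bar>P $$ p\<bar> * N (mat_unit d p))"
    if "finite S" for S
    using that
  proof induction
    case empty
    have "mat d d (\<lambda>p. if p \<in> {} then P $$ p else 0) = 0\<^sub>m d d" by auto
    then show ?case using matrix_norm_eq_0[of "0\<^sub>m d d"] by simp
  next
    case (insert x S)
    have "mat d d (\<lambda>p. if p \<in> insert x S then P $$ p else 0) =
        P $$ x \<cdot>\<^sub>m mat_unit d x + mat d d (\<lambda>p. if p \<in> S then P $$ p else 0)"
      using insert.hyps by (auto simp: mat_unit_def mat_eq_iff)
    also have "N \<dots> \<le> \<bar>P $$ x\<bar> * N (mat_unit d x) + N (mat d d (\<lambda>p. if p \<in> S then P $$ p else 0))"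
      by (rule order_trans[OF matrix_norm_add]) (auto simp: matrix_norm_smult)
    finally show ?case using insert by simp
  qed
  from this[of "{..<d} \<times> {..<d}"]
  have "N (mat d d (\<lambda>p. if p \<in> {..<d} \<times> {..<d} then P $$ p else 0)) \<le>
      (\<Sum>p\<in>{..<d} \<times> {..<d}. \<bar>P $$ p\<bar> * N (mat_unit d p))" by simp
  also have "mat d d (\<lambda>p. if p \<in> {..<d} \<times> {..<d} then P $$ p else 0) = P"
    using P by (auto simp: mat_eq_iff)
  also have "(\<Sum>p\<in>{..<d} \<times> {..<d}. \<bar>P $$ p\<bar> * N (mat_unit d p)) \<le>
      (\<Sum>p\<in>{..<d} \<times> {..<d}. c * N (mat_unit d p))"
    using c P by (intro sum_mono mult_right_mono matrix_norm_nonneg) (auto simp: norm_bound_def)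
  finally show ?thesis by (simp add: sum_distrib_left)
qed

text \<open>\<open>N\<close> is defined on real matrices only, so it cannot be evaluated on a
  complex eigenvector. Instead, passing to powers gives |\<mu>|^n <= const * N(B)^n for all n >= 1,
  and the constant is outgrown if |\<mu>| > N(B).\<close>

lemma eigenvalue_le_matrix_norm:
  assumes B: "B \<in> carrier_mat d d" and ev: "eigenvalue (map_mat complex_of_real B) \<mu>"
  shows "norm \<mu> \<le> N B"
proof (rule ccontr)
  let ?C = "map_mat complex_of_real"
  assume "\<not> norm \<mu> \<le> N B"
  then have less: "N B < norm \<mu>" by simp
  obtain K where K: "\<And>P i j. P \<in> carrier_mat d d \<Longrightarrow> i < d \<Longrightarrow> j < d \<Longrightarrow> \<bar>P $$ (i, j)\<bar> \<le> K * N P"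
    using entry_le_matrix_norm by blast
  have bound: "norm \<mu> ^ Suc k \<le> real d * \<bar>K\<bar> * N B ^ Suc k" for k
  proof -
    let ?P = "B ^\<^sub>m Suc k"
    obtain v where "eigenvector (?C B) v \<mu>"
      using ev by (auto simp: eigenvalue_def)
    then have "eigenvector (?C B ^\<^sub>m Suc k) v (\<mu> ^ Suc k)"
      using eigenvector_pow[of "?C B" d v \<mu> "Suc k"] B
        pow_carrier_mat[of "?C B" d "Suc k"] by (simp add: eigenvector_def del: pow_mat.simps)
    then have "eigenvalue (?C ?P) (\<mu> ^ Suc k)"
      using B by (auto simp: eigenvalue_def of_real_hom.mat_hom_pow simp del: pow_mat.simps)
    moreover have P: "?P \<in> carrier_mat d d" using B by (rule pow_carrier_mat)
    moreover have "norm_bound (?C ?P) (\<bar>K\<bar> * N ?P)"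
    proof (rule norm_boundI)
      fix i j assume "i < dim_row (?C ?P)" "j < dim_col (?C ?P)"
      then have ij: "i < d" "j < d" using P by auto
      have "\<bar>?P $$ (i, j)\<bar> \<le> K * N ?P" using P ij by (rule K)
      also have "\<dots> \<le> \<bar>K\<bar> * N ?P" using P by (intro mult_right_mono matrix_norm_nonneg) auto
      finally show "norm (?C ?P $$ (i, j)) \<le> \<bar>K\<bar> * N ?P" using P ij 
          carrier_matD[OF P] by (simp del: pow_mat.simps)
    qed
    ultimately have "norm (\<mu> ^ Suc k) \<le> real d * (\<bar>K\<bar> * N ?P)"
      by (intro eigenvalue_norm_bound[of "?C ?P"]) auto
    also have "\<dots> \<le> real d * (\<bar>K\<bar> * N B ^ Suc k)"
      by (intro mult_left_mono matrix_norm_pow_le B) auto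
    finally show ?thesis by (simp only: norm_power mult_ac)
  qed
  have "N B \<noteq> 0"
    using bound[of 0] less by auto
  then have pos: "N B > 0"
    using matrix_norm_nonneg[OF B] by simp
  \<comment> \<open>The maximum with 1 excludes k = 0, so \<open>bound\<close> can be used at
    \<open>k - 1\<close>.\<close>
  then obtain k where "max 1 (real d * \<bar>K\<bar>) < (norm \<mu> / N B) ^ k"
    using real_arch_pow[of "norm \<mu> / N B" "max 1 (real d * \<bar>K\<bar>)"] less by auto
  moreover from this have "k \<noteq> 0" by (cases k) auto
  ultimately show False
    using bound[of "k - 1"] pos by (simp add: power_divide field_simps del: power_Suc)
qed

end

section \<open>A Gelfand-type criterion for the spectral radius\<close>

lemma smult_mat_smult_mat: "a \<cdot>\<^sub>m (b \<cdot>\<^sub>m A) = (a * b :: 'a :: semigroup_mult) \<cdot>\<^sub>m A"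
  by (auto simp: mat_eq_iff mult.assoc)

lemma smult_pow_mat:
  fixes A :: "'a :: comm_semiring_1 mat"
  assumes "A \<in> carrier_mat n n"
  shows "(c \<cdot>\<^sub>m A) ^\<^sub>m k = c ^ k \<cdot>\<^sub>m (A ^\<^sub>m k)"
proof (induction k)
  case 0
  then show ?case using assms by (auto simp: mat_eq_iff)
next
  case (Suc k)
  have "(c ^ k \<cdot>\<^sub>m A ^\<^sub>m k) * (c \<cdot>\<^sub>m A) = c ^ k \<cdot>\<^sub>m (A ^\<^sub>m k * (c \<cdot>\<^sub>m A))"
    using assms by (intro mult_smult_assoc_mat[of _ n n _ n]) auto
  also have "A ^\<^sub>m k * (c \<cdot>\<^sub>m A) = c \<cdot>\<^sub>m (A ^\<^sub>m k * A)"
    using assms by (intro mult_smult_distrib[of _ n n _ n]) auto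
  finally show ?case using Suc by (simp add: mult_ac smult_mat_smult_mat)
qed

text \<open>If N(A^n) < r^n, then the n-th power of an eigenvalue of maximal modulus is an
  eigenvalue of A^n and is bounded by N(A^n). Conversely, for q between the spectral radius and r,
  the powers of A/q stay bounded, so N(A^k) is O(q^k) and eventually falls below r^k.\<close>

lemma spectral_radius_less_iff:
  fixes A :: "real mat"
  assumes N: "matrix_norm d N" and A: "A \<in> carrier_mat d d" and "0 < d" "0 < r"
  shows "spectral_radius (map_mat complex_of_real A) < r \<longleftrightarrow> (\<exists>n\<ge>1. N (A ^\<^sub>m n) < r ^ n)"
proof
  let ?A = "map_mat complex_of_real A"
  have A': "?A \<in> carrier_mat d d" using A by simp
  {
    assume "\<exists>n\<ge>1. N (A ^\<^sub>m n) < r ^ n"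
    then obtain n where n: "n \<ge> 1" "N (A ^\<^sub>m n) < r ^ n" by blast
    obtain \<mu> where \<mu>: "eigenvalue ?A \<mu>" "spectral_radius ?A = norm \<mu>"
      using spectral_radius_mem_max(1)[OF A' \<open>0 < d\<close>] by (auto simp: spectrum_def)
    then obtain v where "eigenvector ?A v \<mu>"
      by (auto simp: eigenvalue_def)
    then have "eigenvector (?A ^\<^sub>m n) v (\<mu> ^ n)"
      using eigenvector_pow[OF A', of v \<mu> n] A by (simp add: eigenvector_def)
    then have "eigenvalue (map_mat complex_of_real (A ^\<^sub>m n)) (\<mu> ^ n)"
      using A by (auto simp: eigenvalue_def of_real_hom.mat_hom_pow)
    then have "norm (\<mu> ^ n) \<le> N (A ^\<^sub>m n)"
      using A by (intro eigenvalue_le_matrix_norm[OF N]) auto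
    then have "norm \<mu> ^ n < r ^ n"
      using n by (simp add: norm_power)
    then show "spectral_radius ?A < r"
      using \<mu> \<open>0 < r\<close> by (auto dest: power_less_imp_less_base)
  next
    assume less: "spectral_radius ?A < r"
    have ge: "norm \<mu> \<le> spectral_radius ?A" if "eigenvalue ?A \<mu>" for \<mu>
      using spectral_radius_mem_max(2)[OF A' \<open>0 < d\<close>, of "norm \<mu>"] that by (auto simp: spectrum_def)
    \<comment> \<open>The maximum with 0 makes \<open>q\<close> positive, so that dividing by it is
      legitimate.\<close>
    obtain q where q: "max 0 (spectral_radius ?A) < q" "q < r"
      using dense[of "max 0 (spectral_radius ?A)" r] less \<open>0 < r\<close> by auto
    define B where "B = complex_of_real (1 / q) \<cdot>\<^sub>m ?A"
    have B: "B \<in> carrier_mat d d" using A' by (simp add: B_def)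
    have "spectral_radius B < 1"
    proof -
      obtain \<mu> where \<mu>: "eigenvalue B \<mu>" "spectral_radius B = norm \<mu>"
        using spectral_radius_mem_max(1)[OF B \<open>0 < d\<close>] by (auto simp: spectrum_def)
      obtain v where v: "v \<in> carrier_vec d" "v \<noteq> 0\<^sub>v d" "B *\<^sub>v v = \<mu> \<cdot>\<^sub>v v"
        using \<mu>(1) B by (auto simp: eigenvalue_def eigenvector_def)
      have "?A *\<^sub>v v = (complex_of_real q * \<mu>) \<cdot>\<^sub>v v"
      proof -
        have "?A = complex_of_real q \<cdot>\<^sub>m B"
          using q by (auto simp: B_def mat_eq_iff)
        then have "?A *\<^sub>v v = complex_of_real q \<cdot>\<^sub>v (B *\<^sub>v v)"
          using B v(1) by (auto simp: vec_eq_iff scalar_prod_def sum_distrib_left mult_ac)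
        then show ?thesis using v by (simp add: smult_smult_assoc)
      qed
      then have "eigenvalue ?A (complex_of_real q * \<mu>)"
        using v A by (auto simp: eigenvalue_def eigenvector_def)
      from ge[OF this] have "q * norm \<mu> \<le> spectral_radius ?A"
        using q by (simp add: norm_mult)
      then have "q * norm \<mu> < q * 1"
        using q by linarith
      then have "norm \<mu> < 1"
        using q by (subst (asm) mult_less_cancel_left_pos) auto
      then show ?thesis using \<mu> by simp
    qed
    \<comment> \<open>Via the Jordan normal form, spectral radius below 1 bounds the entries of all
      powers uniformly.\<close>
    then obtain c where c: "\<And>k. norm_bound (B ^\<^sub>m k) c"
      using spectral_radius_jnf_norm_bound_less_1_upper_triangular[OF B] by blast
    define K where "K = c * (\<Sum>p\<in>{..<d} \<times> {..<d}. N (mat_unit d p))"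
    have bound: "N (A ^\<^sub>m k) \<le> q ^ k * K" for k
    proof -
      have "norm_bound (A ^\<^sub>m k) (q ^ k * c)"
      proof (rule norm_boundI)
        fix i j assume "i < dim_row (A ^\<^sub>m k)" "j < dim_col (A ^\<^sub>m k)"
        then have ij: "i < d" "j < d" using A by (auto split: if_splits)
        have "B ^\<^sub>m k = complex_of_real (1 / q) ^ k \<cdot>\<^sub>m map_mat complex_of_real (A ^\<^sub>m k)"
          using A by (simp add: B_def smult_pow_mat[OF A'] of_real_hom.mat_hom_pow)
        then have "norm ((B ^\<^sub>m k) $$ (i, j)) = \<bar>(A ^\<^sub>m k) $$ (i, j)\<bar> / q ^ k"
          using ij carrier_matD[OF pow_carrier_mat[OF A, of k]] q by (simp add: norm_mult norm_power norm_divide power_divide)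
        moreover have "norm ((B ^\<^sub>m k) $$ (i, j)) \<le> c"
          using c[of k] ij B by (auto simp: norm_bound_def)
        ultimately have "\<bar>(A ^\<^sub>m k) $$ (i, j)\<bar> / q ^ k \<le> c"
          by simp
        then show "norm ((A ^\<^sub>m k) $$ (i, j)) \<le> q ^ k * c"
          using q by (simp add: pos_divide_le_eq mult.commute)
      qed
      from matrix_norm_le_entries[OF N pow_carrier_mat[OF A] this] show ?thesis
        by (simp add: K_def mult_ac)
    qed
    \<comment> \<open>Exceeding \<open>K\<close> gives the strict inequality, exceeding 1 forces k
      >= 1.\<close>
    obtain k where k: "max 1 K < (r / q) ^ k"
      using real_arch_pow[of "r / q" "max 1 K"] q by auto
    then have "k \<ge> 1" by (cases k) auto
    moreover have "q ^ k * K < r ^ k"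
      using k q by (simp add: power_divide field_simps)
    ultimately show "\<exists>n\<ge>1. N (A ^\<^sub>m n) < r ^ n"
      using bound[of k] by (intro exI[of _ k]) auto
  }
qed

section \<open>Products of scalar multiples of one matrix\<close>

text \<open>\<open>pow_mat\<close> appends factors on the right, whereas the \<open>foldr\<close> in
  \<open>mat_prod\<close> adds them on the left.\<close>

lemma pow_mat_Suc_left:
  fixes A :: "'a :: semiring_1 mat"
  assumes A: "A \<in> carrier_mat n n"
  shows "A ^\<^sub>m Suc k = A * A ^\<^sub>m k"
proof (induction k)
  case 0
  then show ?case using A by simp
next
  case (Suc k)
  then show ?case
    using A assoc_mult_mat[OF A pow_carrier_mat[OF A, of k] A] by simp
qed

text \<open>Scalars commute with matrices, so all randomness separates into one scalar factor. The
  induction is over an arbitrary list of indices.\<close>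

lemma mat_prod_smult:
  assumes A: "A \<in> carrier_mat d d"
  shows "mat_prod d n (\<lambda>t. c t \<cdot>\<^sub>m A) = (\<Prod>t=1..n. c t) \<cdot>\<^sub>m (A ^\<^sub>m n)"
proof -
  have "foldr (\<lambda>t Q. (c t \<cdot>\<^sub>m A) * Q) ts (1\<^sub>m d) = prod_list (map c ts) \<cdot>\<^sub>m (A ^\<^sub>m length ts)" for ts
  proof (induction ts)
    case Nil
    then show ?case using A by (auto simp: mat_eq_iff)
  next
    case (Cons t ts)
    have "(c t \<cdot>\<^sub>m A) * (p \<cdot>\<^sub>m A ^\<^sub>m k) = (c t * p) \<cdot>\<^sub>m A ^\<^sub>m Suc k" for p k
      using A mult_smult_assoc_mat[OF A, of "p \<cdot>\<^sub>m A ^\<^sub>m k" d "c t"]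
        mult_smult_distrib[OF A, of "A ^\<^sub>m k" d p]
      by (simp add: pow_mat_Suc_left[OF A] smult_mat_smult_mat del: pow_mat.simps)
    then show ?case using Cons by (simp del: pow_mat.simps)
  qed
  from this[of "[1..<Suc n]"] show ?thesis
    by (simp add: mat_prod_def prod.distinct_set_conv_list[symmetric] atLeastLessThanSuc_atLeastAtMost
        del: upt_Suc)
qed

subsection \<open>Expected logarithms\<close>

lemma ereal_expectation_cong_AE:
  assumes "AE \<omega> in M. f \<omega> = g \<omega>"
  shows "ereal_expectation M f = ereal_expectation M g"
proof -
  have "(\<integral>\<^sup>+ \<omega>. e2ennreal (f \<omega>) \<partial>M) = (\<integral>\<^sup>+ \<omega>. e2ennreal (g \<omega>) \<partial>M)"
    and "(\<integral>\<^sup>+ \<omega>. e2ennreal (- f \<omega>) \<partial>M) = (\<integral>\<^sup>+ \<omega>. e2ennreal (- g \<omega>) \<partial>M)"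
    using assms by (auto intro!: nn_integral_cong_AE)
  then show ?thesis by (simp add: ereal_expectation_def)
qed

lemma (in prob_space) ereal_expectation_MInfty: "ereal_expectation M (\<lambda>_. -\<infinity>) = -\<infinity>"
  by (simp add: ereal_expectation_def e2ennreal_neg emeasure_space_1 zero_ennreal.rep_eq)

context prob_space
begin

lemma std_normal_expectation_ln_abs:
  assumes "distributed M lborel X std_normal_density"
  shows "has_bochner_integral M (\<lambda>\<omega>. ln \<bar>X \<omega>\<bar>) (- ((euler_mascheroni + ln 2) / 2))"
  using distributed_integrable[OF assms, of "\<lambda>x. ln \<bar>x\<bar>"]
    distributed_integral[OF assms, of "\<lambda>x. ln \<bar>x\<bar>"] std_normal_ln_abs
  by (simp add: has_bochner_integral_iff)

text \<open>A law with a density has no atom at 0; hence \<open>elog\<close> of |X| is almost surely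
  an ordinary logarithm.\<close>

lemma std_normal_AE_nonzero:
  assumes X: "distributed M lborel X std_normal_density"
  shows "AE \<omega> in M. X \<omega> \<noteq> 0"
proof -
  have "AE x in density lborel std_normal_density. x \<noteq> 0"
    using AE_lborel_singleton[of "0 :: real"] by (subst AE_density) auto
  then have "AE x in distr M lborel X. x \<noteq> 0"
    by (simp only: distributed_distr_eq_density[OF X])
  then show ?thesis
    by (rule AE_distrD[OF distributed_measurable[OF X]])
qed

text \<open>Almost surely no factor vanishes, so the logarithm of the product is a sum and
  expectation is linear. Later \<open>a\<close> is the norm of \<open>A ^\<^sub>m n\<close>, which
  is 0 once a nilpotent \<open>A\<close> has been raised far enough.\<close>

lemma ereal_expectation_elog_product:
  fixes m :: "nat \<Rightarrow> 'a \<Rightarrow> real"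
  assumes m: "\<And>t. 1 \<le> t \<Longrightarrow> distributed M lborel (m t) std_normal_density" and "0 \<le> a"
  shows "ereal_expectation M (\<lambda>\<omega>. elog (\<bar>\<Prod>t=1..n. m t \<omega>\<bar> * a)) =
    (if a = 0 then - \<infinity> else ereal (ln a - real n * ((euler_mascheroni + ln 2) / 2)))"
proof (cases "a = 0")
  case True
  then show ?thesis by (simp add: elog_def ereal_expectation_MInfty)
next
  case False
  have ln_abs: "integrable M (\<lambda>\<omega>. ln \<bar>m t \<omega>\<bar>)"
    "expectation (\<lambda>\<omega>. ln \<bar>m t \<omega>\<bar>) = - ((euler_mascheroni + ln 2) / 2)" if "t \<in> {1..n}" for t
    using std_normal_expectation_ln_abs[OF m[of t]] that by (simp_all add: has_bochner_integral_iff)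
  let ?f = "\<lambda>\<omega>. (\<Sum>t=1..n. ln \<bar>m t \<omega>\<bar>) + ln a"
  have "AE \<omega> in M. \<forall>t\<in>{1..n}. m t \<omega> \<noteq> 0"
    using m by (intro AE_finite_allI std_normal_AE_nonzero) auto
  then have "AE \<omega> in M. elog (\<bar>\<Prod>t=1..n. m t \<omega>\<bar> * a) = ereal (?f \<omega>)"
  proof eventually_elim
    case (elim \<omega>)
    then have "ln (\<Prod>t=1..n. \<bar>m t \<omega>\<bar>) = (\<Sum>t=1..n. ln \<bar>m t \<omega>\<bar>)"
      by (intro ln_prod) auto
    then have "ln (\<bar>\<Prod>t=1..n. m t \<omega>\<bar> * a) = ?f \<omega>"
      using elim False \<open>0 \<le> a\<close> by (simp add: ln_mult abs_prod)
    then show ?case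
      using elim False by (simp add: elog_def)
  qed
  then have "ereal_expectation M (\<lambda>\<omega>. elog (\<bar>\<Prod>t=1..n. m t \<omega>\<bar> * a)) =
      ereal_expectation M (\<lambda>\<omega>. ereal (?f \<omega>))"
    by (rule ereal_expectation_cong_AE)
  also have "\<dots> = ereal (expectation ?f)"
    by (intro ereal_expectation_ereal Bochner_Integration.integrable_add
        Bochner_Integration.integrable_sum) (simp_all add: ln_abs)
  also have "expectation ?f = (\<Sum>t=1..n. - ((euler_mascheroni + ln 2) / 2)) + ln a"
  proof -
    have "expectation ?f = expectation (\<lambda>\<omega>. \<Sum>t=1..n. ln \<bar>m t \<omega>\<bar>) + expectation (\<lambda>_. ln a)"
      by (intro Bochner_Integration.integral_add Bochner_Integration.integrable_sum ln_abs) simp_all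
    also have "expectation (\<lambda>\<omega>. \<Sum>t=1..n. ln \<bar>m t \<omega>\<bar>) = (\<Sum>t=1..n. expectation (\<lambda>\<omega>. ln \<bar>m t \<omega>\<bar>))"
      by (intro Bochner_Integration.integral_sum ln_abs)
    finally show ?thesis by (simp add: ln_abs prob_space)
  qed
  finally show ?thesis using False by simp
qed

end

theorem proposition2p3:
  fixes A :: "real mat" and d :: nat
    and N :: "real mat \<Rightarrow> real"
    and M :: "'a measure" and m :: "nat \<Rightarrow> 'a \<Rightarrow> real"
    and Mt :: "nat \<Rightarrow> 'a \<Rightarrow> real mat"
  assumes "0 < d" and "A \<in> carrier_mat d d"
    and "matrix_norm d N"
    and "prob_space M"
    and "prob_space.indep_vars M (\<lambda>_. borel) m {1..}"
    and "\<And>t. 1 \<le> t \<Longrightarrow> distributed M lborel (m t) std_normal_density"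
    and Mt_def: "\<And>t \<omega>. Mt t \<omega> = m t \<omega> \<cdot>\<^sub>m A"
  shows "((INF n\<in>{1..}. ereal (1 / real n) *
            ereal_expectation M (\<lambda>\<omega>. elog (N (mat_prod d n (\<lambda>t. Mt t \<omega>))))) < 0
          \<longleftrightarrow> spectral_radius (map_mat complex_of_real A) < exp (1 / 2 * (- Digamma 1 + ln 2)))
         \<and> 1.88736 \<le> exp (1 / 2 * (- Digamma 1 + ln 2) :: real)
         \<and> exp (1 / 2 * (- Digamma 1 + ln 2) :: real) < 1.88737"
proof -
  interpret prob_space M by fact
  note A = \<open>A \<in> carrier_mat d d\<close> and N = \<open>matrix_norm d N\<close>
  define c :: real where "c = (euler_mascheroni + ln 2) / 2"
  \<comment> \<open>This rests on Digamma(1) = -\<open>euler_mascheroni\<close>.\<close>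
  have c: "1 / 2 * (- Digamma 1 + ln 2) = c"
    by (simp add: c_def)
  have expectation_eq: "ereal_expectation M (\<lambda>\<omega>. elog (N (mat_prod d n (\<lambda>t. Mt t \<omega>)))) =
      (if N (A ^\<^sub>m n) = 0 then - \<infinity> else ereal (ln (N (A ^\<^sub>m n)) - real n * c))" for n
  proof -
    have "ereal_expectation M (\<lambda>\<omega>. elog (N (mat_prod d n (\<lambda>t. Mt t \<omega>)))) =
        ereal_expectation M (\<lambda>\<omega>. elog (\<bar>\<Prod>t=1..n. m t \<omega>\<bar> * N (A ^\<^sub>m n)))"
      using A by (simp add: Mt_def mat_prod_smult[OF A] matrix_norm_smult[OF N])
    also have "\<dots> = (if N (A ^\<^sub>m n) = 0 then - \<infinity> else ereal (ln (N (A ^\<^sub>m n)) - real n * c))"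
      unfolding c_def using matrix_norm_nonneg[OF N pow_carrier_mat[OF A]] assms(6)
      by (intro ereal_expectation_elog_product)
    finally show ?thesis .
  qed
  \<comment> \<open>When N(A^n) = 0 both sides hold: the term is minus infinity and the power of
    \<open>exp c\<close> is positive.\<close>
  have term_neg_iff: "ereal (1 / real n) *
        ereal_expectation M (\<lambda>\<omega>. elog (N (mat_prod d n (\<lambda>t. Mt t \<omega>)))) < 0 \<longleftrightarrow>
      N (A ^\<^sub>m n) < exp c ^ n" if "n \<ge> 1" for n
  proof (cases "N (A ^\<^sub>m n) = 0")
    case True
    then show ?thesis using that by (simp add: expectation_eq)
  next
    case False
    then have pos: "N (A ^\<^sub>m n) > 0"
      using matrix_norm_nonneg[OF N pow_carrier_mat[OF A, of n]] by simp
    have "ereal (1 / real n) *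
        ereal_expectation M (\<lambda>\<omega>. elog (N (mat_prod d n (\<lambda>t. Mt t \<omega>)))) < 0 \<longleftrightarrow>
        ln (N (A ^\<^sub>m n)) < real n * c"
      using False that by (simp add: expectation_eq divide_less_0_iff)
    also have "\<dots> \<longleftrightarrow> N (A ^\<^sub>m n) < exp (real n * c)"
      using pos by (metis exp_less_cancel_iff exp_ln)
    finally show ?thesis by (simp add: exp_of_nat_mult)
  qed
  \<comment> \<open>An infimum is below 0 exactly when some term is, so no limit in n has to be
    taken.\<close>
  have "(INF n\<in>{1..}. ereal (1 / real n) *
      ereal_expectation M (\<lambda>\<omega>. elog (N (mat_prod d n (\<lambda>t. Mt t \<omega>))))) < 0 \<longleftrightarrow>
      (\<exists>n\<ge>1. N (A ^\<^sub>m n) < exp c ^ n)"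
    unfolding INF_less_iff using term_neg_iff by auto
  also have "\<dots> \<longleftrightarrow> spectral_radius (map_mat complex_of_real A) < exp c"
    using spectral_radius_less_iff[OF N A \<open>0 < d\<close>, of "exp c"] by simp
  finally have "(INF n\<in>{1..}. ereal (1 / real n) *
      ereal_expectation M (\<lambda>\<omega>. elog (N (mat_prod d n (\<lambda>t. Mt t \<omega>))))) < 0 \<longleftrightarrow>
      spectral_radius (map_mat complex_of_real A) < exp c" .
  moreover have "1.88736 \<le> exp c" "exp c < 1.88737"
    using critical_value_bounds by (simp_all add: c_def)
  ultimately show ?thesis unfolding c by simp
qed

end
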